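(* Let $\mathscr{P}\subset\mathbb{N}^p$ be a linear polymatroid. Consider the set $\mathscr{P}_{\le}=\{\mathbf{u}\in\mathbb{N}^p\mid\mathbf{u}\le\mathbf{v}\text{ for some }\mathbf{v}\in\mathscr{P}\}$ and the partially ordered set $\Gamma=\mathscr{P}_{\le}\cup\{\hat1\}$ given by the componentwise order on $\mathscr{P}_{\le}$ with a maximum $\hat1$ added. Let $\mu_\Gamma$ be the Möbius function of $\Gamma$. Then the set $$\mu\text{-supp}(\mathscr{P})=\{\mathbf{u}\in\mathscr{P}_{\le}\mid\mu_\Gamma(\mathbf{u},\hat1)\ne0\}$$ is a generalized polymatroid.
   Context: A linear polymatroid is a set of the following form: given a field $\Bbbk$ and $\Bbbk$-subspaces $V_1,\ldots,V_p$ of a finite-dimensional $\Bbbk$-vector space $V$, $\mathscr{P}$ is the set of all $\mathbf{y}\in\mathbb{N}^p$ with $\sum_{j\in\mathfrak{J}}y_j\le\dim_\Bbbk(\sum_{j\in\mathfrak{J}}V_j)$ for all $\mathfrak{J}\subseteq\{1,\ldots,p\}$ and $\sum_{i=1}^py_i=\dim_\Bbbk(\sum_{i=1}^pV_i)$. The Möbius function $\mu_\Gamma:\Gamma\times\Gamma\to\mathbb{Z}$ is determined by $\mu_\Gamma(\mathbf{u},\mathbf{v})=0$ if $\mathbf{u}\not\le\mathbf{v}$, $\mu_\Gamma(\mathbf{u},\mathbf{u})=1$, and $\sum_{\mathbf{u}\le\mathbf{w}\le\mathbf{v}}\mu_\Gamma(\mathbf{u},\mathbf{w})=0$ for $\mathbf{u}<\mathbf{v}$.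 A (base) polymatroid is a finite subset $\mathscr{Q}\subset\mathbb{N}^q$, all of whose elements have the same coordinate sum, such that for all $\mathbf{u},\mathbf{v}\in\mathscr{Q}$ and $i$ with $u_i>v_i$ there is $j$ with $u_j<v_j$ and $\mathbf{u}-\mathbf{e}_i+\mathbf{e}_j\in\mathscr{Q}$. A generalized polymatroid is a finite subset $\mathscr{G}\subset\mathbb{N}^p$ such that $\{(\mathbf{a},M-|\mathbf{a}|)\in\mathbb{N}^{p+1}\mid\mathbf{a}\in\mathscr{G}\}$ is a polymatroid, where $|\mathbf{a}|$ is the coordinate sum and $M=\max\{|\mathbf{a}|\mid\mathbf{a}\in\mathscr{G}\}$. *)

theory Defs
  imports Complex_Main "HOL-Library.Set_Algebras" "HOL-Library.Lattice_Constructions"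
begin

text \<open>
  A vector in \<open>\<nat>\<^sup>p\<close> is a function on the natural numbers that vanishes outside \<open>{..<p}\<close>; the
  coordinates are numbered from \<open>0\<close> to \<open>p - 1\<close>. On these vectors the library's pointwise order of
  functions is the componentwise order.
\<close>

definition nat_vecs :: "nat \<Rightarrow> (nat \<Rightarrow> nat) set" where
  "nat_vecs p = {u. \<forall>i\<ge>p. u i = 0}"

definition coord_sum :: "nat \<Rightarrow> (nat \<Rightarrow> nat) \<Rightarrow> nat" where
  "coord_sum p u = (\<Sum>i<p. u i)"

text \<open>
  In the exchange condition \<open>i\<close> and \<open>j\<close> are distinct and \<open>u i > 0\<close>, so the simultaneous update is
  \<open>u - e\<^sub>i + e\<^sub>j\<close>.
\<close>

definition polymatroid :: "nat \<Rightarrow> (nat \<Rightarrow> nat) set \<Rightarrow> bool" where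
  "polymatroid q Q \<longleftrightarrow>
     finite Q \<and> Q \<subseteq> nat_vecs q \<and>
     (\<forall>u\<in>Q. \<forall>v\<in>Q. coord_sum q u = coord_sum q v) \<and>
     (\<forall>u\<in>Q. \<forall>v\<in>Q. \<forall>i<q. u i > v i \<longrightarrow>
        (\<exists>j<q. u j < v j \<and> u(i := u i - 1, j := u j + 1) \<in> Q))"

definition generalized_polymatroid :: "nat \<Rightarrow> (nat \<Rightarrow> nat) set \<Rightarrow> bool" where
  "generalized_polymatroid p G \<longleftrightarrow>
     finite G \<and> G \<subseteq> nat_vecs p \<and>
     (let M = Max (coord_sum p ` G)
      in polymatroid (Suc p) ((\<lambda>a. a(p := M - coord_sum p a)) ` G))"

text \<open>
  The sum of the subspaces is the elementwise sum of sets from \<^theory>\<open>HOL-Library.Set_Algebras\<close>;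
  the empty sum is \<open>{0}\<close>. The ambient space is the whole type \<open>'v\<close>.
\<close>

definition linear_polymatroid ::
    "('k::field \<Rightarrow> 'v::ab_group_add \<Rightarrow> 'v) \<Rightarrow> nat \<Rightarrow> (nat \<Rightarrow> nat) set \<Rightarrow> bool" where
  "linear_polymatroid scale p P \<longleftrightarrow>
     (\<exists>Basis. finite_dimensional_vector_space scale Basis) \<and>
     (\<exists>V :: nat \<Rightarrow> 'v set.
        (\<forall>j<p. module.subspace scale (V j)) \<and>
        P = {y \<in> nat_vecs p.
               (\<forall>J\<subseteq>{..<p}. (\<Sum>j\<in>J. y j) \<le> vector_space.dim scale (\<Sum>j\<in>J. V j)) \<and>
               (\<Sum>i<p. y i) = vector_space.dim scale (\<Sum>i<p. V i)})"

text \<open>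
  The Moebius function of a finite set \<open>S\<close> with the order inherited from its type, by recursion on
  the second argument. The values for infinite \<open>S\<close>, or for arguments outside \<open>S\<close>, carry no meaning.
  The lemmas below show that on \<open>S\<close> it is the unique function with the three defining properties.
\<close>

function moebius :: "'a::order set \<Rightarrow> 'a \<Rightarrow> 'a \<Rightarrow> int" where
  "moebius S u v =
     (if infinite S \<or> \<not> u \<le> v then 0
      else if u = v then 1
      else - (\<Sum>w\<in>{w\<in>S. u \<le> w \<and> w < v}. moebius S u w))"
  by pat_completeness auto
termination
proof (relation "measure (\<lambda>(S, u, v). card {x\<in>S. x < v})", simp)
  fix S :: "'a set" and u v w
  assume "\<not> (infinite S \<or> \<not> u \<le> v)" and w: "w \<in> {w\<in>S. u \<le> w \<and> w < v}"
  then have "finite {x\<in>S. x < v}" by simp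
  moreover have "{x\<in>S. x < w} \<subset> {x\<in>S. x < v}" using w by auto
  ultimately show "((S, u, w), (S, u, v)) \<in> measure (\<lambda>(S, u, v). card {x\<in>S. x < v})"
    by (simp add: psubset_card_mono)
qed

declare moebius.simps [simp del]

lemma moebius_not_le: "\<not> u \<le> v \<Longrightarrow> moebius S u v = 0"
  by (subst moebius.simps) simp

lemma moebius_refl: "finite S \<Longrightarrow> moebius S u u = 1"
  by (subst moebius.simps) simp

lemma moebius_sum:
  assumes "finite S" "v \<in> S" "u < v"
  shows "(\<Sum>w\<in>{w\<in>S. u \<le> w \<and> w \<le> v}. moebius S u w) = 0"
proof -
  have "{w\<in>S. u \<le> w \<and> w \<le> v} = insert v {w\<in>S. u \<le> w \<and> w < v}"
    using assms by (auto simp: order.order_iff_strict)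
  moreover have "moebius S u v = - (\<Sum>w\<in>{w\<in>S. u \<le> w \<and> w < v}. moebius S u w)"
    using assms by (subst moebius.simps) (auto simp: less_imp_le)
  ultimately show ?thesis
    using assms by simp
qed

lemma moebius_unique:
  fixes m :: "'a::order \<Rightarrow> 'a \<Rightarrow> int"
  assumes fin: "finite S"
    and m0: "\<And>u v. u \<in> S \<Longrightarrow> v \<in> S \<Longrightarrow> \<not> u \<le> v \<Longrightarrow> m u v = 0"
    and m1: "\<And>u. u \<in> S \<Longrightarrow> m u u = 1"
    and msum: "\<And>u v. u \<in> S \<Longrightarrow> v \<in> S \<Longrightarrow> u < v \<Longrightarrow>
      (\<Sum>w\<in>{w\<in>S. u \<le> w \<and> w \<le> v}. m u w) = 0"
    and u: "u \<in> S" and "v \<in> S"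
  shows "m u v = moebius S u v"
  using \<open>v \<in> S\<close>
proof (induction "card {x\<in>S. x < v}" arbitrary: v rule: less_induct)
  case less
  consider "\<not> u \<le> v" | "u = v" | "u < v" by (auto simp: order.order_iff_strict)
  then show ?case
  proof cases
    case 3
    let ?A = "{w\<in>S. u \<le> w \<and> w < v}"
    have "{w\<in>S. u \<le> w \<and> w \<le> v} = insert v ?A"
      using less.prems 3 by (auto simp: order.order_iff_strict)
    then have "m u v = - (\<Sum>w\<in>?A. m u w)"
      using msum[OF u less.prems 3] fin by simp
    also have "(\<Sum>w\<in>?A. m u w) = (\<Sum>w\<in>?A. moebius S u w)"
    proof (rule sum.cong[OF refl])
      fix w assume w: "w \<in> ?A"
      then have "{x\<in>S. x < w} \<subset> {x\<in>S. x < v}" by auto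
      then have "card {x\<in>S. x < w} < card {x\<in>S. x < v}"
        using fin by (simp add: psubset_card_mono)
      then show "m u w = moebius S u w" using less.hyps w by auto
    qed
    finally show ?thesis using 3 fin by (subst moebius.simps) (auto simp: less_imp_le)
  qed (use m0 m1 u less.prems fin in \<open>auto simp: moebius_not_le moebius_refl\<close>)
qed

definition down_closure :: "nat \<Rightarrow> (nat \<Rightarrow> nat) set \<Rightarrow> (nat \<Rightarrow> nat) set" where
  "down_closure p P = {u \<in> nat_vecs p. \<exists>v\<in>P. u \<le> v}"

text \<open>
  The poset \<open>\<Gamma>\<close>; the order on \<^typ>\<open>'a top\<close> makes \<^const>\<open>top.Top\<close> the maximum above all \<open>top.Value u\<close>.
\<close>

definition Gamma_poset :: "nat \<Rightarrow> (nat \<Rightarrow> nat) set \<Rightarrow> (nat \<Rightarrow> nat) top set" where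
  "Gamma_poset p P = insert top.Top (top.Value ` down_closure p P)"

definition mu_supp :: "nat \<Rightarrow> (nat \<Rightarrow> nat) set \<Rightarrow> (nat \<Rightarrow> nat) set" where
  "mu_supp p P =
     {u \<in> down_closure p P. moebius (Gamma_poset p P) (top.Value u) top.Top \<noteq> 0}"

lemma finite_nat_vecs_le: "finite {u \<in> nat_vecs p. u \<le> v}"
proof (rule finite_subset)
  let ?F = "{u. \<forall>i. (i \<in> {..<p} \<longrightarrow> u i \<in> (\<Union>i<p. {..v i})) \<and> (i \<notin> {..<p} \<longrightarrow> u i = 0)}"
  show "{u \<in> nat_vecs p. u \<le> v} \<subseteq> ?F"
  proof
    fix u assume u: "u \<in> {u \<in> nat_vecs p. u \<le> v}"
    show "u \<in> ?F"
    proof (intro CollectI allI conjI impI)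
      fix i
      show "u i \<in> (\<Union>i<p. {..v i})" if "i \<in> {..<p}"
      proof (rule UN_I)
        show "u i \<in> {..v i}" using u by (simp add: le_fun_def)
      qed (rule that)
      show "u i = 0" if "i \<notin> {..<p}"
        using u that by (simp add: nat_vecs_def)
    qed
  qed
  show "finite ?F" by (rule finite_set_of_finite_funs) simp_all
qed

lemma finite_linear_polymatroid:
  assumes "linear_polymatroid scale p P"
  shows "finite P"
proof -
  obtain n where n: "\<And>y. y \<in> P \<Longrightarrow> y \<in> nat_vecs p \<and> (\<Sum>i<p. y i) = n"
    using assms unfolding linear_polymatroid_def by blast
  have "P \<subseteq> {u \<in> nat_vecs p. u \<le> (\<lambda>_. n)}"
  proof (clarify, intro conjI le_funI)
    fix y i assume y: "y \<in> P"
    show "y \<in> nat_vecs p" using n[OF y] by blast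
    show "y i \<le> n"
    proof (cases "i < p")
      case True
      then have "y i \<le> (\<Sum>i<p. y i)" by (intro member_le_sum) auto
      then show ?thesis using n[OF y] by simp
    qed (use n[OF y] in \<open>simp add: nat_vecs_def\<close>)
  qed
  then show ?thesis by (rule finite_subset) (rule finite_nat_vecs_le)
qed

lemma finite_Gamma_poset:
  assumes "finite P"
  shows "finite (Gamma_poset p P)"
proof -
  have "down_closure p P = (\<Union>v\<in>P. {u \<in> nat_vecs p. u \<le> v})"
    by (auto simp: down_closure_def)
  then show ?thesis
    using assms by (simp add: Gamma_poset_def finite_nat_vecs_le)
qed

end

theory Submission
  imports Defs
begin

text \<open>
  Since every interval of \<open>P\<^sub>\<le>\<close> is a product of chains, \<open>\<mu>(u, 1)\<close> is, up to sign, the sum of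
  \<open>(-1)\<^bsup>|S|\<^esup>\<close> over all \<open>S\<close> with \<open>u + e\<^sub>S \<in> P\<^sub>\<le>\<close>. These \<open>S\<close> are the independent sets of a matroid,
  and by deletion and contraction the sum is nonzero iff the matroid has no coloop. In terms of the
  rank function \<open>f\<close> on the ground set \<open>E\<close>, this says \<open>f(E) < f(B) + u(E - B) + |E - B|\<close> for all
  proper subsets \<open>B\<close> of \<open>E\<close>. Together with \<open>u(A) \<le> f(A)\<close>, and after a slack coordinate is added,
  these become the inequalities \<open>x(X) \<le> F(X)\<close> with \<open>F\<close> submodular on pairs whose union is not
  everything. For the exchange, if no \<open>j\<close> worked for \<open>i\<close>, then the coordinates where \<open>u < v\<close> would be
  covered by \<open>u\<close>-tight sets avoiding \<open>i\<close>, whose union is again tight, and comparing \<open>u\<close> and \<open>v\<close> on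
  that union and its complement contradicts the equality of their coordinate sums.
\<close>

section \<open>Independence systems and their alternating sums\<close>

text \<open>Only subsets of \<open>E\<close> are constrained, so deletion keeps the predicate
  \<open>I\<close> and merely shrinks the ground set.\<close>

definition matroid_on :: "'a set \<Rightarrow> ('a set \<Rightarrow> bool) \<Rightarrow> bool" where
  "matroid_on E I \<longleftrightarrow> I {} \<and> (\<forall>S T. S \<subseteq> T \<and> T \<subseteq> E \<and> I T \<longrightarrow> I S) \<and>
     (\<forall>S T. S \<subseteq> E \<and> T \<subseteq> E \<and> I S \<and> I T \<and> card S < card T \<longrightarrow> (\<exists>t\<in>T - S. I (insert t S)))"

text \<open>These are the bases of the matroid. Measuring them by cardinality makes any two equally
  large at once.\<close>

definition max_indep :: "'a set \<Rightarrow> ('a set \<Rightarrow> bool) \<Rightarrow> 'a set \<Rightarrow> bool" where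
  "max_indep E I B \<longleftrightarrow> B \<subseteq> E \<and> I B \<and> (\<forall>S. S \<subseteq> E \<and> I S \<longrightarrow> card S \<le> card B)"

definition coloop :: "'a set \<Rightarrow> ('a set \<Rightarrow> bool) \<Rightarrow> 'a \<Rightarrow> bool" where
  "coloop E I e \<longleftrightarrow> e \<in> E \<and> (\<forall>S. S \<subseteq> E - {e} \<and> I S \<longrightarrow> I (insert e S))"

text \<open>For a matroid this is minus the reduced Euler characteristic of the complex of
  independent sets.\<close>

definition alt_sum :: "'a set \<Rightarrow> ('a set \<Rightarrow> bool) \<Rightarrow> int" where
  "alt_sum E I = (\<Sum>S | S \<subseteq> E \<and> I S. (-1) ^ card S)"

lemma matroid_onD:
  assumes "matroid_on E I"
  shows "I {}" "\<And>S T. S \<subseteq> T \<Longrightarrow> T \<subseteq> E \<Longrightarrow> I T \<Longrightarrow> I S"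
    "\<And>S T. S \<subseteq> E \<Longrightarrow> T \<subseteq> E \<Longrightarrow> I S \<Longrightarrow> I T \<Longrightarrow> card S < card T \<Longrightarrow> \<exists>t\<in>T - S. I (insert t S)"
  using assms unfolding matroid_on_def by blast+

lemma matroid_on_subset: "matroid_on E I \<Longrightarrow> D \<subseteq> E \<Longrightarrow> matroid_on D I"
  unfolding matroid_on_def by (meson subset_trans)

lemma matroid_on_contract:
  assumes M: "matroid_on (insert e E) I" and "finite E" "e \<notin> E" "I {e}"
  shows "matroid_on E (\<lambda>S. I (insert e S))"
  unfolding matroid_on_def
proof (intro conjI allI impI; (elim conjE)?)
  show "I {e}" by fact
  show "I (insert e S)" if "S \<subseteq> T" "T \<subseteq> E" "I (insert e T)" for S T
    using matroid_onD(2)[OF M, of "insert e S" "insert e T"] that by blast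
  fix S T assume *: "S \<subseteq> E" "T \<subseteq> E" "I (insert e S)" "I (insert e T)" "card S < card T"
  have "card (insert e S) < card (insert e T)"
    using * assms by (subst (1 2) card_insert_disjoint) (auto intro: finite_subset)
  then obtain t where "t \<in> insert e T - insert e S" "I (insert t (insert e S))"
    using matroid_onD(3)[OF M, of "insert e S" "insert e T"] * by blast
  then show "\<exists>t\<in>T - S. I (insert e (insert t S))"
    by (metis DiffD1 DiffD2 DiffI insertCI insertE insert_commute)
qed

text \<open>Take a largest independent set among those containing \<open>S\<close>. A larger
  independent set anywhere in \<open>E\<close> would let the exchange axiom enlarge it.\<close>

lemma ex_max_indep_superset:
  assumes M: "matroid_on E I" and "finite E" "S \<subseteq> E" "I S"
  shows "\<exists>B. S \<subseteq> B \<and> max_indep E I B"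
proof -
  define C where "C = {T. S \<subseteq> T \<and> T \<subseteq> E \<and> I T}"
  have "finite C" "C \<noteq> {}" unfolding C_def using assms by auto
  then have mx: "Max (card ` C) \<in> card ` C" by simp
  then obtain T where T: "T \<in> C" "card T = Max (card ` C)" by auto
  have "card R \<le> card T" if R: "R \<subseteq> E" "I R" for R
  proof (rule ccontr)
    assume "\<not> card R \<le> card T"
    then obtain t where t: "t \<in> R - T" "I (insert t T)"
      using matroid_onD(3)[OF M, of T R] R T unfolding C_def by auto
    then have "insert t T \<in> C" using T R unfolding C_def by auto
    then have "card (insert t T) \<le> card T" using T(2) \<open>finite C\<close> by auto
    moreover have "finite T" using T \<open>finite E\<close> unfolding C_def by (auto intro: finite_subset)
    ultimately show False using t by simp
  qed
  then show ?thesis using T unfolding max_indep_def C_def by blast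
qed

lemma alt_sum_insert:
  assumes "finite E" "e \<notin> E"
  shows "alt_sum (insert e E) I = alt_sum E I - alt_sum E (\<lambda>S. I (insert e S))"
proof -
  let ?A = "{S. S \<subseteq> E \<and> I S}" and ?B = "{S. S \<subseteq> E \<and> I (insert e S)}"
  have "{S. S \<subseteq> insert e E \<and> I S} = ?A \<union> insert e ` ?B"
  proof (intro equalityI subsetI)
    fix S assume S: "S \<in> {S. S \<subseteq> insert e E \<and> I S}"
    show "S \<in> ?A \<union> insert e ` ?B"
    proof (cases "e \<in> S")
      case True
      then have "S = insert e (S - {e})" "S - {e} \<in> ?B" using S by (auto simp: insert_absorb)
      then show ?thesis by blast
    qed (use S in auto)
  qed auto
  moreover have "?A \<inter> insert e ` ?B = {}" using assms by auto
  moreover have "inj_on (insert e) ?B"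
    using assms by (intro inj_onI) (metis (no_types, lifting) insert_ident mem_Collect_eq subsetD)
  moreover have "(\<Sum>S\<in>?B. (-1::int) ^ card (insert e S)) = - (\<Sum>S\<in>?B. (-1) ^ card S)"
    unfolding sum_negf[symmetric]
  proof (rule sum.cong[OF refl])
    fix S assume "S \<in> ?B"
    then have "finite S" "e \<notin> S" using assms finite_subset by auto
    then show "(-1::int) ^ card (insert e S) = - ((-1) ^ card S)" by simp
  qed
  ultimately show ?thesis
    using assms unfolding alt_sum_def by (simp add: sum.union_disjoint sum.reindex)
qed

text \<open>The sets with and without \<open>e\<close> pair off with opposite signs.\<close>

lemma alt_sum_cancel:
  assumes "finite E" "e \<in> E" "\<And>S. S \<subseteq> E - {e} \<Longrightarrow> I (insert e S) = I S"
  shows "alt_sum E I = 0"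
proof -
  have E: "E = insert e (E - {e})" using assms(2) by auto
  have "alt_sum (E - {e}) (\<lambda>S. I (insert e S)) = alt_sum (E - {e}) I"
    unfolding alt_sum_def by (intro sum.cong Collect_cong conj_cong refl) (rule assms(3))
  then show ?thesis
    by (subst E, subst alt_sum_insert) (use assms in auto)
qed

lemma alt_sum_coloop:
  assumes M: "matroid_on E I" and "finite E" "coloop E I e"
  shows "alt_sum E I = 0"
proof (rule alt_sum_cancel)
  show "finite E" by fact
  show e: "e \<in> E" using assms(3) unfolding coloop_def by blast
  fix S assume S: "S \<subseteq> E - {e}"
  then have "I S" if "I (insert e S)"
    using matroid_onD(2)[OF M, of S "insert e S"] that e by blast
  moreover have "I (insert e S)" if "I S"
    using assms(3) that S unfolding coloop_def by blast
  ultimately show "I (insert e S) = I S" by blast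
qed

text \<open>Delete \<open>x\<close> and compare a base \<open>T\<close> above \<open>S\<close> with
  a base \<open>N\<close> through \<open>e\<close>. As \<open>x\<close> is a coloop of the
  contraction, it can be added to \<open>N\<close>, which gives a set larger than \<open>T\<close>.
  The exchange then enlarges \<open>T\<close>, and by maximality of \<open>T\<close> the new element
  can only be \<open>x\<close>.\<close>

lemma coloop_contract:
  assumes M: "matroid_on (insert e E) I" and fin: "finite E" and "e \<notin> E" "I {e}"
    and x: "coloop E (\<lambda>S. I (insert e S)) x"
  shows "coloop (insert e E) I x"
  unfolding coloop_def
proof (intro conjI allI impI; (elim conjE)?)
  have xE: "x \<in> E" using x unfolding coloop_def by auto
  then show "x \<in> insert e E" by auto
  let ?D = "insert e E - {x}"
  have MD: "matroid_on ?D I" using M by (rule matroid_on_subset) auto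
  fix S assume S: "S \<subseteq> ?D" "I S"
  obtain T where T: "S \<subseteq> T" "max_indep ?D I T"
    using ex_max_indep_superset[OF MD _ S] fin by auto
  obtain N where N: "{e} \<subseteq> N" "max_indep ?D I N"
    using ex_max_indep_superset[OF MD, of "{e}"] fin assms xE by auto
  have "N - {e} \<subseteq> E - {x}" and eN: "insert e (N - {e}) = N" "I N"
    using N unfolding max_indep_def by auto
  then have "I (insert e (insert x (N - {e})))"
    using x unfolding coloop_def by simp
  then have "I (insert x N)"
    using eN(1) by (simp only: insert_commute[of e x])
  moreover have "finite N" "x \<notin> N" "N \<subseteq> insert e E" "T \<subseteq> insert e E" "I T"
    using N T fin unfolding max_indep_def by (auto intro: finite_subset)
  moreover have "card T = card N"
    using N T unfolding max_indep_def by (meson order_antisym)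
  ultimately obtain t where t: "t \<in> insert x N - T" "I (insert t T)"
    using matroid_onD(3)[OF M, of T "insert x N"] xE by (metis card_insert_disjoint insertI2
      insert_subset lessI)
  have "t = x"
  proof (rule ccontr)
    assume "t \<noteq> x"
    then have "insert t T \<subseteq> ?D" using t N T unfolding max_indep_def by blast
    then have "card (insert t T) \<le> card T" using t T unfolding max_indep_def by blast
    moreover have "finite T" using \<open>T \<subseteq> insert e E\<close> fin by (auto intro: finite_subset)
    ultimately show False using t by simp
  qed
  then show "I (insert x S)"
    using matroid_onD(2)[OF M, of "insert x S" "insert x T"] t(2) T(1) \<open>T \<subseteq> insert e E\<close> xE
    by (auto dest: subset_insertI2)
qed

text \<open>Deletion and contraction of an element that is neither a loop nor a coloop give sums of
  opposite sign, so that nothing cancels in \<open>alt_sum_insert\<close>.\<close>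

lemma alt_sum_sign:
  assumes "finite E" "matroid_on E I" "max_indep E I B" "\<nexists>e. coloop E I e"
  shows "(-1) ^ card B * alt_sum E I > 0"
  using assms
proof (induction E arbitrary: I B rule: finite_induct)
  case empty
  then have "{S. S \<subseteq> {} \<and> I S} = {{}}" "B = {}"
    using matroid_onD(1) by (auto simp: max_indep_def)
  then show ?case by (simp add: alt_sum_def)
next
  case (insert e E)
  note M = insert.prems(1)
  note B = insert.prems(2)
  have ME: "matroid_on E I" using M by (rule matroid_on_subset) auto
  \<comment> \<open>The deletion may have a coloop, and then its sum is 0. Hence the inequality is
    weak here, and strictness comes from the contraction.\<close>
  have weak: "(-1) ^ card B' * alt_sum E I \<ge> 0" if "max_indep E I B'" for B'
    using insert.IH[OF ME that] alt_sum_coloop[OF ME insert.hyps(1)]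
    by (cases "\<exists>x. coloop E I x") (auto intro: less_imp_le)
  show ?case
  proof (cases "I {e}")
    \<comment> \<open>Here \<open>e\<close> is a loop: sets through it contribute nothing, and the
      deletion inherits the base and the absence of coloops.\<close>
    case False
    then have no: "\<not> I (insert e S)" if "S \<subseteq> E" for S
      using matroid_onD(2)[OF M, of "{e}" "insert e S"] that by auto
    have "e \<notin> B"
    proof
      assume "e \<in> B"
      then have "insert e (B - {e}) = B" "B - {e} \<subseteq> E" using B unfolding max_indep_def by auto
      then show False using no B unfolding max_indep_def by metis
    qed
    then have "max_indep E I B" using B unfolding max_indep_def by blast
    moreover have "\<nexists>x. coloop E I x"
    proof
      assume "\<exists>x. coloop E I x"
      then obtain x where x: "coloop E I x" by blast
      have "coloop (insert e E) I x"
        unfolding coloop_def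
      proof (intro conjI allI impI; (elim conjE)?)
        show "x \<in> insert e E" using x unfolding coloop_def by auto
        fix S assume S: "S \<subseteq> insert e E - {x}" "I S"
        have "e \<notin> S"
          using no[of "S - {e}"] S by (metis Diff_subset insert_Diff subset_insert_iff subset_trans)
        then have "S \<subseteq> E - {x}" using S by auto
        then show "I (insert x S)" using x S unfolding coloop_def by blast
      qed
      then show False using insert.prems(3) by blast
    qed
    moreover have "alt_sum E (\<lambda>S. I (insert e S)) = 0"
      unfolding alt_sum_def using no by (intro sum.neutral) auto
    ultimately show ?thesis
      using insert.IH[OF ME] alt_sum_insert[OF insert.hyps] by simp
  next
    case True
    let ?J = "\<lambda>S. I (insert e S)"
    have MJ: "matroid_on E ?J" using M insert.hyps True by (intro matroid_on_contract)
    \<comment> \<open>Since \<open>e\<close> is not a coloop, some base \<open>C\<close> avoids it,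
      so the deletion has the same rank. A base \<open>D\<close> through \<open>e\<close> shows that
      the rank of the contraction is one less.\<close>
    obtain S where S: "S \<subseteq> E" "I S" "\<not> I (insert e S)"
      using insert.prems(3) insert.hyps unfolding coloop_def by auto
    obtain C where C: "S \<subseteq> C" "max_indep (insert e E) I C"
      using ex_max_indep_superset[OF M, of S] S insert.hyps by auto
    have "e \<notin> C"
      using S C matroid_onD(2)[OF M, of "insert e S" C] unfolding max_indep_def by blast
    then have C': "max_indep E I C" using C unfolding max_indep_def by blast
    have cC: "card C = card B" using C B unfolding max_indep_def by (auto intro: order_antisym)
    obtain D where D: "{e} \<subseteq> D" "max_indep (insert e E) I D"
      using ex_max_indep_superset[OF M, of "{e}"] True insert.hyps by auto
    have cD: "card D = card B" using D B unfolding max_indep_def by (auto intro: order_antisym)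
    have finD: "finite D" using D insert.hyps unfolding max_indep_def by (auto intro: finite_subset)
    have D': "max_indep E ?J (D - {e})"
      unfolding max_indep_def
    proof (intro conjI allI impI; (elim conjE)?)
      show "D - {e} \<subseteq> E" using D unfolding max_indep_def by auto
      show "I (insert e (D - {e}))"
        using D unfolding max_indep_def by (metis insert_Diff insert_subset)
      fix R assume R: "R \<subseteq> E" "I (insert e R)"
      then have "card (insert e R) \<le> card D" using D unfolding max_indep_def by (meson insert_mono)
      moreover have "card (insert e R) = Suc (card R)"
        using R insert.hyps by (intro card_insert_disjoint) (auto intro: finite_subset)
      ultimately show "card R \<le> card (D - {e})" using D finD by auto
    qed
    have "\<nexists>x. coloop E ?J x"
      using coloop_contract[OF M insert.hyps True] insert.prems(3) by blast
    then have "(-1) ^ card (D - {e}) * alt_sum E ?J > 0"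
      using insert.IH[OF MJ D'] by blast
    moreover have "card D = Suc (card (D - {e}))"
      using D finD by (metis card_Suc_Diff1 insert_subset)
    ultimately have "(-1) ^ card D * alt_sum E ?J < 0" by simp
    moreover have "(-1) ^ card B * alt_sum (insert e E) I
        = (-1) ^ card C * alt_sum E I - (-1) ^ card D * alt_sum E ?J"
      unfolding alt_sum_insert[OF insert.hyps] cC cD by (rule right_diff_distrib)
    ultimately show ?thesis
      using weak[OF C'] by linarith
  qed
qed

lemma alt_sum_nonzero_iff:
  assumes "finite E" "matroid_on E I"
  shows "alt_sum E I \<noteq> 0 \<longleftrightarrow> (\<nexists>e. coloop E I e)"
proof
  show "\<nexists>e. coloop E I e" if "alt_sum E I \<noteq> 0"
    using that alt_sum_coloop[OF assms(2,1)] by metis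
  obtain B where B: "max_indep E I B"
    using ex_max_indep_superset[OF assms(2,1), of "{}"] matroid_onD(1)[OF assms(2)] by auto
  show "alt_sum E I \<noteq> 0" if "\<nexists>e. coloop E I e"
  proof
    assume "alt_sum E I = 0"
    then show False using alt_sum_sign[OF assms B that] by simp
  qed
qed

section \<open>Polymatroids given by a submodular function\<close>

text \<open>Submodularity makes the union of two tight sets tight. Everything is relative to
  \<open>Z\<close>, so that the lemma also applies to an \<open>F\<close> that is submodular only on
  the subsets of a smaller set.\<close>

lemma tight_cover:
  fixes F :: "'a set \<Rightarrow> nat" and w :: "'a \<Rightarrow> nat"
  assumes "finite Z" and F0: "F {} = 0"
    and submod: "\<And>X Y. X \<subseteq> Z \<Longrightarrow> Y \<subseteq> Z \<Longrightarrow> F (X \<union> Y) + F (X \<inter> Y) \<le> F X + F Y"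
    and le: "\<And>X. X \<subseteq> Z \<Longrightarrow> sum w X \<le> F X"
    and "T \<subseteq> Z" and cov: "\<And>t. t \<in> T \<Longrightarrow> \<exists>X\<subseteq>Z. t \<in> X \<and> sum w X = F X"
  shows "\<exists>X\<subseteq>Z. T \<subseteq> X \<and> sum w X = F X"
proof -
  have "finite T" using assms(1,5) by (rule rev_finite_subset)
  then show ?thesis using cov
  proof (induction T rule: finite_induct)
    case empty
    then show ?case using F0 by (intro exI[of _ "{}"]) auto
  next
    case (insert t T)
    then obtain X where X: "X \<subseteq> Z" "T \<subseteq> X" "sum w X = F X" by auto
    obtain Y where Y: "Y \<subseteq> Z" "t \<in> Y" "sum w Y = F Y" using insert.prems by auto
    have "sum w (X \<union> Y) + sum w (X \<inter> Y) = sum w X + sum w Y"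
      using X Y \<open>finite Z\<close> by (intro sum.union_inter) (auto intro: finite_subset)
    moreover have "sum w (X \<union> Y) \<le> F (X \<union> Y)" "sum w (X \<inter> Y) \<le> F (X \<inter> Y)"
      using X Y by (auto intro!: le)
    ultimately have "sum w (X \<union> Y) = F (X \<union> Y)"
      using submod[OF X(1) Y(1)] X Y by linarith
    then show ?case using X Y by (intro exI[of _ "X \<union> Y"]) auto
  qed
qed

text \<open>\<open>bump u S\<close> is \<open>u + e\<^sub>S\<close>.\<close>

definition bump :: "('a \<Rightarrow> nat) \<Rightarrow> 'a set \<Rightarrow> 'a \<Rightarrow> nat" where
  "bump u S = (\<lambda>i. u i + of_bool (i \<in> S))"

lemma bump_empty [simp]: "bump u {} = u"
  by (simp add: bump_def)

lemma sum_bump: "finite A \<Longrightarrow> sum (bump u S) A = sum u A + card (A \<inter> S)"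
  by (simp add: bump_def sum.distrib of_bool_def sum.If_cases)

lemma bump_mono: "S \<subseteq> T \<Longrightarrow> bump u S i \<le> bump u T i"
  by (auto simp: bump_def)

lemma bump_insert: "t \<notin> S \<Longrightarrow> bump u (insert t S) = bump (bump u S) {t}"
  by (auto simp: bump_def)

section \<open>Independent vectors of a submodular function and the matroid of their unit
  increments\<close>

locale submodular_function =
  fixes E :: "'a set" and f :: "'a set \<Rightarrow> nat"
  assumes finite_E: "finite E" and f_empty: "f {} = 0"
    and f_submod: "\<And>A B. A \<subseteq> E \<Longrightarrow> B \<subseteq> E \<Longrightarrow> f (A \<union> B) + f (A \<inter> B) \<le> f A + f B"
begin

definition indep :: "('a \<Rightarrow> nat) \<Rightarrow> bool" where
  "indep u \<longleftrightarrow> (\<forall>A\<subseteq>E. sum u A \<le> f A)"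

lemma fin: "A \<subseteq> E \<Longrightarrow> finite A"
  using finite_E by (rule rev_finite_subset)

lemma indepD: "indep u \<Longrightarrow> A \<subseteq> E \<Longrightarrow> sum u A \<le> f A"
  unfolding indep_def by blast

lemma indep_antimono: "indep v \<Longrightarrow> (\<And>i. i \<in> E \<Longrightarrow> u i \<le> v i) \<Longrightarrow> indep u"
  unfolding indep_def by (meson le_trans subsetD sum_mono)

lemma indep_tight_cover:
  assumes "indep w" "Z \<subseteq> E" "T \<subseteq> Z" "\<And>t. t \<in> T \<Longrightarrow> \<exists>X\<subseteq>Z. t \<in> X \<and> sum w X = f X"
  shows "\<exists>X\<subseteq>Z. T \<subseteq> X \<and> sum w X = f X"
  using assms fin[of Z] f_empty by (intro tight_cover) (auto intro!: f_submod indepD)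

text \<open>Raising coordinate \<open>i\<close> adds at most one to any sum, so a set violating its
  bound afterwards contains \<open>i\<close> and was tight before.\<close>

lemma not_indep_bump:
  assumes "indep w" "\<not> indep (bump w {i})"
  shows "\<exists>X\<subseteq>E. i \<in> X \<and> sum w X = f X"
proof -
  obtain X where X: "X \<subseteq> E" "\<not> sum (bump w {i}) X \<le> f X"
    using assms unfolding indep_def by auto
  moreover have "sum w X \<le> f X" using assms X by (auto intro: indepD)
  ultimately show ?thesis
    using sum_bump[OF fin[OF X(1)], of w "{i}"]
    by (intro exI[of _ X]) (cases "i \<in> X"; simp)
qed

text \<open>Raise coordinates one at a time. When none can be raised, every element of
  \<open>E\<close> lies in a tight set, and the union of these makes \<open>E\<close> itself
  tight.\<close>

lemma ex_base:
  assumes "indep u"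
  shows "\<exists>v. indep v \<and> (\<forall>i. u i \<le> v i) \<and> (\<forall>i. i \<notin> E \<longrightarrow> v i = u i) \<and> sum v E = f E"
  using assms
proof (induction "f E - sum u E" arbitrary: u rule: less_induct)
  case less
  show ?case
  proof (cases "\<exists>i\<in>E. indep (bump u {i})")
    case True
    then obtain i where i: "i \<in> E" "indep (bump u {i})" by blast
    have "sum (bump u {i}) E = sum u E + 1" using i finite_E by (simp add: sum_bump)
    moreover have "sum (bump u {i}) E \<le> f E" using i by (auto intro: indepD)
    ultimately have "f E - sum (bump u {i}) E < f E - sum u E" by linarith
    then obtain v where v: "indep v" "\<And>j. bump u {i} j \<le> v j"
      "\<And>j. j \<notin> E \<Longrightarrow> v j = bump u {i} j" "sum v E = f E"
      using less.hyps[of "bump u {i}"] i by blast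
    moreover have "u j \<le> v j" for j
      using v(2)[of j] bump_mono[of "{}" "{i}" u j] by simp
    moreover have "v j = u j" if "j \<notin> E" for j
      using v(3)[OF that] that i by (auto simp: bump_def)
    ultimately show ?thesis by blast
  next
    case False
    then have "\<exists>X\<subseteq>E. E \<subseteq> X \<and> sum u X = f X"
      using less.prems by (intro indep_tight_cover) (auto intro: not_indep_bump)
    then have "sum u E = f E" by (metis subset_antisym)
    then show ?thesis using less.prems by blast
  qed
qed

text \<open>If no element of T - S could be added, T - S would lie in a set \<open>X\<close> tight
  for u + e_S. Then \<open>T\<close> has at most as many elements in \<open>X\<close> as
  \<open>S\<close>, and outside \<open>X\<close> it is contained in \<open>S\<close>, so it cannot
  be larger.\<close>

lemma matroid_on_bump:
  assumes "indep u"
  shows "matroid_on E (\<lambda>S. indep (bump u S))"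
  unfolding matroid_on_def
proof (intro conjI allI impI; (elim conjE)?)
  show "indep (bump u {})" using assms by simp
  show "indep (bump u S)" if "S \<subseteq> T" "indep (bump u T)" for S T
    using that by (auto intro: indep_antimono bump_mono)
  fix S T assume *: "S \<subseteq> E" "T \<subseteq> E" "indep (bump u S)" "indep (bump u T)" "card S < card T"
  show "\<exists>t\<in>T - S. indep (bump u (insert t S))"
  proof (rule ccontr)
    assume "\<not> (\<exists>t\<in>T - S. indep (bump u (insert t S)))"
    then have "\<exists>X\<subseteq>E. T - S \<subseteq> X \<and> sum (bump u S) X = f X"
      using * by (intro indep_tight_cover) (auto intro!: not_indep_bump simp flip: bump_insert)
    then obtain X where X: "X \<subseteq> E" "T - S \<subseteq> X" "sum (bump u S) X = f X" by blast
    have "sum (bump u T) X \<le> f X" using * X by (auto intro: indepD)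
    then have "card (X \<inter> T) \<le> card (X \<inter> S)"
      using X fin[OF X(1)] by (auto simp: sum_bump)
    moreover have "card T = card (X \<inter> T) + card (T - X)" "card S = card (X \<inter> S) + card (S - X)"
      using * fin by (metis Int_commute card_Int_Diff)+
    moreover have "card (T - X) \<le> card (S - X)"
      using X * fin by (intro card_mono) auto
    ultimately show False using * by simp
  qed
qed

text \<open>This is the term f(B) - u(B) + |E - B| of the matroid rank formula, shifted by u(E) to
  avoid subtraction on the natural numbers.\<close>

definition deficiency :: "('a \<Rightarrow> nat) \<Rightarrow> 'a set \<Rightarrow> nat" where
  "deficiency u B = f B + sum u (E - B) + card (E - B)"

lemma sum_split: "A \<subseteq> E \<Longrightarrow> sum u E = sum u A + sum u (E - A)" for u :: "'a \<Rightarrow> nat"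
  using finite_E by (metis add.commute sum.subset_diff)

text \<open>The minimum of \<open>deficiency u\<close> exceeds the matroid rank by the constant \<open>sum u E\<close>, and the
  coloops are the elements outside its smallest minimizer.\<close>

lemma no_coloop_iff:
  assumes u: "indep u"
  shows "(\<nexists>i. coloop E (\<lambda>S. indep (bump u S)) i) \<longleftrightarrow> (\<forall>B. B \<subset> E \<longrightarrow> f E < deficiency u B)"
proof
  note M = matroid_on_bump[OF u]
  assume nc: "\<nexists>i. coloop E (\<lambda>S. indep (bump u S)) i"
  show "\<forall>B. B \<subset> E \<longrightarrow> f E < deficiency u B"
  proof (rule ccontr)
    assume "\<not> (\<forall>B. B \<subset> E \<longrightarrow> f E < deficiency u B)"
    then obtain B0 where B0: "B0 \<subset> E" "deficiency u B0 \<le> f E" by (meson not_less)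
    then obtain B where B: "B \<subset> E" and min: "\<And>A. A \<subset> E \<Longrightarrow> deficiency u B \<le> deficiency u A"
      using ex_has_least_nat[of "\<lambda>B. B \<subset> E" B0 "deficiency u"] by blast
    \<comment> \<open>The choice of \<open>B0\<close> extends the minimality of \<open>B\<close>
      from the proper subsets to \<open>E\<close> itself.\<close>
    have "deficiency u E = f E" by (simp add: deficiency_def)
    then have min': "deficiency u B \<le> deficiency u A" if "A \<subseteq> E" for A
      using min[of A] min[OF B0(1)] B0(2) that by (cases "A = E") auto
    obtain i where i: "i \<in> E - B" using B by auto
    \<comment> \<open>Every base \<open>R\<close> contains E - B: its maximality yields a set
      \<open>X\<close> of deficiency u(E) + |R|, and then minimality of \<open>B\<close> forces E -
      B to be no larger than R - B.\<close>
    have "coloop E (\<lambda>S. indep (bump u S)) i"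
      unfolding coloop_def
    proof (intro conjI allI impI; (elim conjE)?)
      show "i \<in> E" using i by auto
      fix S assume S: "S \<subseteq> E - {i}" "indep (bump u S)"
      obtain R where R: "S \<subseteq> R" "max_indep E (\<lambda>S. indep (bump u S)) R"
        using ex_max_indep_superset[OF M finite_E _ S(2)] S(1) by auto
      then have RE: "R \<subseteq> E" "indep (bump u R)" unfolding max_indep_def by auto
      have "\<not> indep (bump (bump u R) {j})" if j: "j \<in> E - R" for j
      proof
        assume "indep (bump (bump u R) {j})"
        then have "card (insert j R) \<le> card R"
          using R j unfolding max_indep_def by (metis DiffD1 DiffD2 bump_insert insert_subset)
        then show False using j fin[OF RE(1)] by simp
      qed
      then have "\<exists>X\<subseteq>E. E - R \<subseteq> X \<and> sum (bump u R) X = f X"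
        using RE by (intro indep_tight_cover) (auto intro: not_indep_bump)
      then obtain X where X: "X \<subseteq> E" "E - R \<subseteq> X" "sum u X + card (X \<inter> R) = f X"
        using fin by (auto simp: sum_bump)
      have "card R = card (R \<inter> X) + card (R - X)"
        using fin[OF RE(1)] by (rule card_Int_Diff)
      moreover have "R - X = E - X" using X RE by auto
      ultimately have "deficiency u X = sum u E + card R"
        using X sum_split[OF X(1), of u] by (simp add: deficiency_def Int_commute)
      then have "deficiency u B \<le> sum u E + card R" using min'[OF X(1)] by simp
      moreover have "sum u B + card (B \<inter> R) \<le> f B"
        using indepD[OF RE(2), of B] B fin by (simp add: sum_bump)
      moreover have "sum u E = sum u B + sum u (E - B)" using B by (intro sum_split) auto
      moreover have "card R = card (B \<inter> R) + card (R - B)"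
        using fin[OF RE(1)] by (metis Int_commute card_Int_Diff)
      ultimately have "card (E - B) \<le> card (R - B)" by (simp add: deficiency_def)
      then have "R - B = E - B"
        using RE finite_E by (intro card_seteq) auto
      then have "insert i S \<subseteq> R" using i R by auto
      then show "indep (bump u (insert i S))"
        using RE by (auto intro: indep_antimono bump_mono)
    qed
    then show False using nc by blast
  qed
next
  assume def: "\<forall>B. B \<subset> E \<longrightarrow> f E < deficiency u B"
  show "\<nexists>i. coloop E (\<lambda>S. indep (bump u S)) i"
  proof
    assume "\<exists>i. coloop E (\<lambda>S. indep (bump u S)) i"
    then obtain i where i: "i \<in> E"
      and coloop: "\<And>S. S \<subseteq> E - {i} \<Longrightarrow> indep (bump u S) \<Longrightarrow> indep (bump u (insert i S))"
      unfolding coloop_def by blast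
    \<comment> \<open>Take a base \<open>S\<close> of the deletion of \<open>i\<close>. The
      remaining elements other than \<open>i\<close> lie in a tight set \<open>X\<close> avoiding
      \<open>i\<close>, whose deficiency is u(E) + |S| + 1. That is at most f(E), because
      \<open>i\<close> can be added to \<open>S\<close>.\<close>
    let ?Z = "E - {i}"
    have M: "matroid_on ?Z (\<lambda>S. indep (bump u S))"
      using matroid_on_bump[OF u] by (rule matroid_on_subset) auto
    obtain S where S: "max_indep ?Z (\<lambda>S. indep (bump u S)) S"
      using ex_max_indep_superset[OF M, of "{}"] finite_E u by auto
    then have SZ: "S \<subseteq> ?Z" "indep (bump u S)" unfolding max_indep_def by auto
    have iS: "i \<notin> S" "indep (bump u (insert i S))" "S \<subseteq> E" using SZ coloop by auto
    have "\<exists>X\<subseteq>?Z. j \<in> X \<and> sum (bump u S) X = f X" if j: "j \<in> ?Z - S" for j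
    proof -
      have "\<not> indep (bump (bump u S) {j})"
      proof
        assume "indep (bump (bump u S) {j})"
        then have "card (insert j S) \<le> card S"
          using S j unfolding max_indep_def by (metis DiffD1 DiffD2 bump_insert insert_subset)
        then show False using j fin[OF iS(3)] by simp
      qed
      then obtain X where X: "X \<subseteq> E" "j \<in> X" "sum (bump u S) X = f X"
        using not_indep_bump[OF SZ(2)] by blast
      \<comment> \<open>The vector stays independent when \<open>i\<close> is raised too, so a set
        through \<open>i\<close> cannot be tight.\<close>
      have "i \<notin> X"
      proof
        assume "i \<in> X"
        have "sum (bump u (insert i S)) X \<le> f X" using iS X by (auto intro: indepD)
        then show False
          using X fin[OF X(1)] \<open>i \<in> X\<close> by (simp add: sum_bump bump_insert[OF iS(1)])
      qed
      then show ?thesis using X by auto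
    qed
    then have "\<exists>X\<subseteq>?Z. ?Z - S \<subseteq> X \<and> sum (bump u S) X = f X"
      using SZ by (intro indep_tight_cover) auto
    then obtain X where X: "X \<subseteq> ?Z" "?Z - S \<subseteq> X" and tight: "sum (bump u S) X = f X"
      by blast
    have XE: "X \<subset> E" using X i by auto
    have "sum u X + card (X \<inter> S) = f X"
      using tight sum_bump[of X] XE fin by auto
    moreover
    have "card (insert i S) = card (insert i S \<inter> X) + card (insert i S - X)"
      using fin[OF iS(3)] by (intro card_Int_Diff) simp
    moreover have "insert i S \<inter> X = X \<inter> S" "insert i S - X = E - X" using X iS i by blast+
    ultimately have "sum u E + card (insert i S) = deficiency u X"
      using sum_split[of X u] XE unfolding deficiency_def by simp
    moreover have "sum u E + card (insert i S) \<le> f E"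
      using indepD[OF iS(2), of E] finite_E i iS(3) by (simp add: sum_bump Int_absorb1)
    moreover have "f E < deficiency u X" using def XE by blast
    ultimately show False by linarith
  qed
qed

end

section \<open>The Moebius function below the added maximum\<close>

text \<open>For u \<le> w in \<open>nat_vecs p\<close> this is the Moebius function of a product of
  chains. Its users supply the test u \<le> w.\<close>

definition cube_sign :: "('a \<Rightarrow> nat) \<Rightarrow> ('a \<Rightarrow> nat) \<Rightarrow> int" where
  "cube_sign u w = (if \<forall>i. w i \<le> u i + 1 then (-1) ^ card {i. u i < w i} else 0)"

lemma bump_in_nat_vecs: "u \<in> nat_vecs p \<Longrightarrow> S \<subseteq> {..<p} \<Longrightarrow> bump u S \<in> nat_vecs p"
  by (auto simp: nat_vecs_def bump_def)

lemma le_bump: "u \<le> bump u S"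
  by (simp add: bump_def le_fun_def)

lemma less_bump_iff: "u i < bump u S i \<longleftrightarrow> i \<in> S"
  by (simp add: bump_def)

text \<open>Only the vectors u + e_S have a nonzero sign, and each determines its
  \<open>S\<close>.\<close>

lemma sum_cube_sign:
  assumes "finite A" "A \<subseteq> nat_vecs p"
  shows "(\<Sum>w\<in>{w\<in>A. u \<le> w}. cube_sign u w) = alt_sum {..<p} (\<lambda>S. bump u S \<in> A)"
proof -
  let ?C = "{S. S \<subseteq> {..<p} \<and> bump u S \<in> A}"
  have inj: "inj_on (bump u) ?C"
    by (intro inj_onI set_eqI) (metis less_bump_iff)
  have "cube_sign u w = 0" if w: "w \<in> {w\<in>A. u \<le> w} - bump u ` ?C" for w
  proof (rule ccontr)
    assume "cube_sign u w \<noteq> 0"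
    then have le: "w i \<le> u i + 1" for i by (auto simp: cube_sign_def split: if_splits)
    have "w i = bump u {i. u i < w i} i" for i
    proof -
      have "u i \<le> w i" using w by (auto dest: le_funD)
      then show ?thesis using le[of i] by (auto simp: bump_def)
    qed
    then have eq: "w = bump u {i. u i < w i}" by blast
    have "{i. u i < w i} \<subseteq> {..<p}"
    proof
      fix i assume "i \<in> {i. u i < w i}"
      then have "w i \<noteq> 0" by auto
      then show "i \<in> {..<p}" using w assms(2) unfolding nat_vecs_def by (cases "i < p") auto
    qed
    then have "{i. u i < w i} \<in> ?C" using w eq by auto
    then have "w \<in> bump u ` ?C" using eq by blast
    then show False using w by blast
  qed
  then have "(\<Sum>w\<in>{w\<in>A. u \<le> w}. cube_sign u w) = (\<Sum>w\<in>bump u ` ?C. cube_sign u w)"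
    using assms by (intro sum.mono_neutral_right) (auto intro: le_bump)
  also have "\<dots> = (\<Sum>S\<in>?C. cube_sign u (bump u S))"
    by (simp add: sum.reindex[OF inj])
  also have "\<dots> = (\<Sum>S\<in>?C. (-1) ^ card S)"
    by (intro sum.cong refl) (simp add: cube_sign_def less_bump_iff, simp add: bump_def)
  finally show ?thesis by (simp add: alt_sum_def)
qed

text \<open>Some coordinate \<open>j\<close> has u(j) < v(j). Toggling \<open>j\<close> in
  \<open>S\<close> does not affect whether u + e_S lies below \<open>v\<close>, so the terms cancel
  in pairs.\<close>

lemma sum_cube_sign_interval:
  assumes D: "finite D" "D \<subseteq> nat_vecs p"
    and down: "\<And>u v. v \<in> D \<Longrightarrow> u \<in> nat_vecs p \<Longrightarrow> u \<le> v \<Longrightarrow> u \<in> D"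
    and "u \<in> D" "v \<in> D" "u < v"
  shows "(\<Sum>w\<in>{w\<in>D. u \<le> w \<and> w \<le> v}. cube_sign u w) = 0"
proof -
  let ?A = "{w\<in>D. w \<le> v}"
  have uv: "u \<le> v" "u \<noteq> v" using assms(6) by auto
  then obtain j where j: "u j \<noteq> v j" by blast
  then have uj: "u j < v j" using uv le_funD[OF uv(1), of j] by auto
  then have jp: "j < p" using D(2) assms(5) unfolding nat_vecs_def by (cases "j < p") auto
  have "alt_sum {..<p} (\<lambda>S. bump u S \<in> ?A) = 0"
  proof (rule alt_sum_cancel)
    fix S assume S: "S \<subseteq> {..<p} - {j}"
    have "bump u T \<in> ?A \<longleftrightarrow> bump u T \<le> v" if "T \<subseteq> {..<p}" for T
      using down[OF assms(5) bump_in_nat_vecs[of u p T]] that assms(4) D(2) by auto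
    moreover have "bump u (insert j S) \<le> v \<longleftrightarrow> bump u S \<le> v"
    proof
      show "bump u S \<le> v" if "bump u (insert j S) \<le> v"
        using that unfolding le_fun_def by (meson bump_mono le_trans subset_insertI)
      assume le: "bump u S \<le> v"
      show "bump u (insert j S) \<le> v"
      proof (rule le_funI)
        fix i
        show "bump u (insert j S) i \<le> v i"
          using le_funD[OF le, of i] uj by (cases "i = j") (auto simp: bump_def)
      qed
    qed
    ultimately show "(bump u (insert j S) \<in> ?A) = (bump u S \<in> ?A)"
      using S jp by (metis (no_types, lifting) Diff_subset insert_subset lessThan_iff subset_trans)
  qed (use jp in auto)
  moreover have "{w\<in>D. u \<le> w \<and> w \<le> v} = {w\<in>?A. u \<le> w}" by auto
  ultimately show ?thesis using sum_cube_sign[of ?A p u] D by auto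
qed

lemma moebius_Top:
  assumes D: "finite D" "D \<subseteq> nat_vecs p"
    and down: "\<And>u v. v \<in> D \<Longrightarrow> u \<in> nat_vecs p \<Longrightarrow> u \<le> v \<Longrightarrow> u \<in> D"
    and u: "u \<in> D"
  shows "moebius (insert top.Top (top.Value ` D)) (top.Value u) top.Top =
    - alt_sum {..<p} (\<lambda>S. bump u S \<in> D)"
proof -
  let ?S = "insert top.Top (top.Value ` D)"
  \<comment> \<open>The candidate takes the product formula on \<open>D\<close> and, at the maximum,
    the value forced by the vanishing sum. Uniqueness identifies it with
    \<open>moebius\<close>.\<close>
  define m where "m x y = (case x of top.Top \<Rightarrow> (if y = top.Top then 1 else 0)
    | top.Value u \<Rightarrow> (case y of top.Top \<Rightarrow> - (\<Sum>w\<in>{w\<in>D. u \<le> w}. cube_sign u w)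
      | top.Value v \<Rightarrow> (if u \<le> v then cube_sign u v else 0)))" for x y
  have "m (top.Value u) top.Top = moebius ?S (top.Value u) top.Top"
  proof (rule moebius_unique)
    show "finite ?S" using D by simp
    show "m x y = 0" if "\<not> x \<le> y" for x y
      using that by (auto simp: m_def split: top.splits)
    show "m x x = 1" for x
      by (auto simp: m_def cube_sign_def split: top.splits)
    fix x y assume xy: "x \<in> ?S" "y \<in> ?S" "x < y"
    then obtain a where a: "x = top.Value a" "a \<in> D"
      by (auto simp: less_top_Top)
    show "(\<Sum>w\<in>{w\<in>?S. x \<le> w \<and> w \<le> y}. m x w) = 0"
    proof (cases y)
      case Top
      have "{w\<in>?S. x \<le> w \<and> w \<le> y} = insert top.Top (top.Value ` {w\<in>D. a \<le> w})"
        using a Top by auto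
      moreover have "(\<Sum>w\<in>top.Value ` {w\<in>D. a \<le> w}. m x w) = (\<Sum>w\<in>{w\<in>D. a \<le> w}. cube_sign a w)"
        using a by (subst sum.reindex) (auto simp: inj_on_def m_def intro!: sum.cong)
      ultimately show ?thesis
        using D(1) a Top by (subst \<open>{w\<in>?S. _ w} = _\<close>, subst sum.insert) (auto simp: m_def)
    next
      case (Value b)
      then have b: "b \<in> D" "a < b" using xy a by auto
      have "{w\<in>?S. x \<le> w \<and> w \<le> y} = top.Value ` {w\<in>D. a \<le> w \<and> w \<le> b}"
        using a Value less_eq_top_is_Top by auto
      then have "(\<Sum>w\<in>{w\<in>?S. x \<le> w \<and> w \<le> y}. m x w) =
          (\<Sum>w\<in>{w\<in>D. a \<le> w \<and> w \<le> b}. m x (top.Value w))"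
        by (simp add: sum.reindex inj_on_def)
      also have "\<dots> = (\<Sum>w\<in>{w\<in>D. a \<le> w \<and> w \<le> b}. cube_sign a w)"
        using a by (intro sum.cong) (auto simp: m_def)
      also have "\<dots> = 0"
        by (rule sum_cube_sign_interval[OF D]) (use down a b in auto)
      finally show ?thesis .
    qed
  qed (use u in auto)
  then show ?thesis by (simp add: m_def sum_cube_sign[OF D])
qed

section \<open>The exchange property\<close>

lemma tight_exchange:
  fixes F :: "'a set \<Rightarrow> nat" and u v :: "'a \<Rightarrow> nat"
  assumes fin: "finite E" and F0: "F {} = 0"
    and submod: "\<And>X Y. X \<subseteq> E \<Longrightarrow> Y \<subseteq> E \<Longrightarrow> X \<union> Y \<noteq> E \<Longrightarrow> F (X \<union> Y) + F (X \<inter> Y) \<le> F X + F Y"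
    and u: "\<And>X. X \<subseteq> E \<Longrightarrow> sum u X \<le> F X" and v: "\<And>X. X \<subseteq> E \<Longrightarrow> sum v X \<le> F X"
    and eq: "sum u E = sum v E" and i: "i \<in> E" "v i < u i"
  shows "\<exists>j\<in>E. u j < v j \<and> (\<forall>X\<subseteq>E. sum (u(i := u i - 1, j := u j + 1)) X \<le> F X)"
proof (rule ccontr)
  assume no: "\<not> ?thesis"
  let ?Z = "E - {i}" and ?T = "{j\<in>E. u j < v j}"
  have finX: "finite X" if "X \<subseteq> E" for X using that fin by (rule finite_subset)
  have "\<exists>X\<subseteq>?Z. ?T \<subseteq> X \<and> sum u X = F X"
  proof (rule tight_cover)
    \<comment> \<open>Leaving out \<open>i\<close> keeps unions different from \<open>E\<close>, as
      \<open>submod\<close> demands.\<close>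
    show "F (X \<union> Y) + F (X \<inter> Y) \<le> F X + F Y" if "X \<subseteq> ?Z" "Y \<subseteq> ?Z" for X Y
      using that i(1) by (intro submod) auto
    show "?T \<subseteq> ?Z" using i(2) by auto
    fix j assume j: "j \<in> ?T"
    then obtain X where X: "X \<subseteq> E" "\<not> sum (u(i := u i - 1, j := u j + 1)) X \<le> F X"
      using no by blast
    \<comment> \<open>Adding e_i back avoids truncated subtraction. The modified sum exceeds the old
      one by at most one, so a violated \<open>X\<close> must be tight for \<open>u\<close>, contain
      \<open>j\<close> and avoid \<open>i\<close>.\<close>
    have "bump (u(i := u i - 1, j := u j + 1)) {i} = bump u {j}"
      using i(2) j by (auto simp: bump_def fun_eq_iff)
    then have "sum (u(i := u i - 1, j := u j + 1)) X + card (X \<inter> {i}) = sum u X + card (X \<inter> {j})"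
      by (metis sum_bump finX[OF X(1)])
    then have "i \<notin> X \<and> j \<in> X \<and> sum u X = F X"
      using X(2) u[OF X(1)] by (cases "i \<in> X"; cases "j \<in> X") simp_all
    then show "\<exists>X\<subseteq>?Z. j \<in> X \<and> sum u X = F X" using X(1) by blast
  qed (use fin F0 u in auto)
  then obtain X where X: "X \<subseteq> ?Z" "?T \<subseteq> X" "sum u X = F X" by blast
  have XE: "X \<subseteq> E" using X by auto
  \<comment> \<open>Outside \<open>X\<close> no coordinate of \<open>v\<close> exceeds that of
    \<open>u\<close>, and at \<open>i\<close> it is strictly smaller.\<close>
  have "sum v (E - X) < sum u (E - X)"
    using X i fin by (intro sum_strict_mono_ex1) (auto simp: not_less[symmetric])
  moreover have "sum v X \<le> sum u X" using v[OF XE] X by simp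
  ultimately show False
    using eq sum.subset_diff[OF XE fin, of u] sum.subset_diff[OF XE fin, of v] by simp
qed

text \<open>The rank function of the set of all \<open>u\<close> with \<open>f E < deficiency u B\<close> for \<open>B \<subset> E\<close>, where
  \<open>E = {..<p}\<close>, after adding the slack coordinate \<open>p\<close>. It is submodular only on pairs of sets
  whose union is not everything.\<close>

definition slack_rank :: "nat \<Rightarrow> (nat set \<Rightarrow> nat) \<Rightarrow> nat set \<Rightarrow> nat" where
  "slack_rank p f X =
     (if p \<in> X then (if X = {..<Suc p} then f {..<p} else f (X - {p}) + card ({..<p} - X) - 1)
      else f X)"

text \<open>Such an \<open>X\<close> misses a coordinate below \<open>p\<close>, so the subtraction
  of 1 in \<open>slack_rank\<close> is not truncated.\<close>

lemma slack_rank_in: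
  assumes "X \<subseteq> {..<Suc p}" "p \<in> X" "X \<noteq> {..<Suc p}"
  shows "slack_rank p f X + 1 = f (X - {p}) + card ({..<p} - X)"
proof -
  have "{..<p} - X \<noteq> {}" using assms by (auto simp: lessThan_Suc)
  then have "card ({..<p} - X) > 0" by (simp add: card_gt_0_iff)
  then show ?thesis using assms by (simp add: slack_rank_def)
qed

text \<open>The number of missing coordinates is modular when \<open>p\<close> lies in both sets,
  and it only shrinks towards the union when \<open>p\<close> lies in one. The terms -1 balance
  because the union is not the full set, whose value lacks the -1.\<close>

lemma slack_rank_submod:
  assumes "submodular_function {..<p} f"
    and X: "X \<subseteq> {..<Suc p}" and Y: "Y \<subseteq> {..<Suc p}" and ne: "X \<union> Y \<noteq> {..<Suc p}"
  shows "slack_rank p f (X \<union> Y) + slack_rank p f (X \<inter> Y) \<le> slack_rank p f X + slack_rank p f Y"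
proof -
  interpret submodular_function "{..<p}" f by fact
  have mixed: "slack_rank p f (X \<union> Y) + slack_rank p f (X \<inter> Y) \<le> slack_rank p f X + slack_rank p f Y"
    if XY: "X \<subseteq> {..<Suc p}" "Y \<subseteq> {..<Suc p}" "X \<union> Y \<noteq> {..<Suc p}" "p \<in> X" "p \<notin> Y" for X Y
  proof -
    have "f ((X - {p}) \<union> Y) + f ((X - {p}) \<inter> Y) \<le> f (X - {p}) + f Y"
      using XY by (intro f_submod) (auto simp: lessThan_Suc)
    moreover have "(X \<union> Y) - {p} = (X - {p}) \<union> Y" "X \<inter> Y = (X - {p}) \<inter> Y" using XY by auto
    moreover have "slack_rank p f X + 1 = f (X - {p}) + card ({..<p} - X)"
      using XY by (intro slack_rank_in) auto
    moreover have "slack_rank p f (X \<union> Y) + 1 = f ((X \<union> Y) - {p}) + card ({..<p} - (X \<union> Y))"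
      using XY by (intro slack_rank_in) auto
    moreover have "slack_rank p f Y = f Y" "slack_rank p f (X \<inter> Y) = f (X \<inter> Y)"
      using XY by (simp_all add: slack_rank_def)
    moreover have "card ({..<p} - (X \<union> Y)) \<le> card ({..<p} - X)" by (intro card_mono) auto
    ultimately show ?thesis by simp
  qed
  consider "p \<notin> X" "p \<notin> Y" | "p \<in> X" "p \<notin> Y" | "p \<notin> X" "p \<in> Y" | "p \<in> X" "p \<in> Y" by blast
  then show ?thesis
  proof cases
    case 1
    then show ?thesis
      using X Y f_submod[of X Y] by (auto simp: slack_rank_def lessThan_Suc)
  next
    case 2
    then show ?thesis using mixed X Y ne by blast
  next
    case 3
    then show ?thesis using mixed[of Y X] X Y ne by (simp add: Un_commute Int_commute add.commute)
  next
    case 4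
    have "f ((X - {p}) \<union> (Y - {p})) + f ((X - {p}) \<inter> (Y - {p})) \<le> f (X - {p}) + f (Y - {p})"
      using X Y by (intro f_submod) auto
    moreover have "(X - {p}) \<union> (Y - {p}) = X \<union> Y - {p}" "(X - {p}) \<inter> (Y - {p}) = X \<inter> Y - {p}"
      by auto
    moreover have "slack_rank p f X + 1 = f (X - {p}) + card ({..<p} - X)"
      "slack_rank p f Y + 1 = f (Y - {p}) + card ({..<p} - Y)"
      "slack_rank p f (X \<union> Y) + 1 = f (X \<union> Y - {p}) + card ({..<p} - (X \<union> Y))"
      "slack_rank p f (X \<inter> Y) + 1 = f (X \<inter> Y - {p}) + card ({..<p} - (X \<inter> Y))"
      by (intro slack_rank_in; use X Y ne 4 in blast)+
    moreover have "card ({..<p} - X) + card ({..<p} - Y)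
        = card ({..<p} - (X \<inter> Y)) + card ({..<p} - (X \<union> Y))"
      using card_Un_Int[of "{..<p} - X" "{..<p} - Y"] by (simp add: Diff_Int Diff_Un)
    ultimately show ?thesis by simp
  qed
qed

section \<open>The Moebius support\<close>

text \<open>Independence passes to smaller vectors, and \<open>ex_base\<close> raises an independent
  vector to one in \<open>P\<close>.\<close>

lemma down_closure_eq:
  assumes "submodular_function {..<p} f"
    and P: "P = {y \<in> nat_vecs p. submodular_function.indep {..<p} f y \<and> sum y {..<p} = f {..<p}}"
  shows "down_closure p P = {u \<in> nat_vecs p. submodular_function.indep {..<p} f u}"
proof -
  interpret submodular_function "{..<p}" f by fact
  show ?thesis
  proof (intro equalityI subsetI)
    fix u assume "u \<in> down_closure p P"
    then show "u \<in> {u \<in> nat_vecs p. indep u}"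
      unfolding down_closure_def P by (auto dest: le_funD intro: indep_antimono)
  next
    fix u assume u: "u \<in> {u \<in> nat_vecs p. indep u}"
    then obtain v where v: "indep v" "\<forall>i. u i \<le> v i" "\<forall>i. i \<notin> {..<p} \<longrightarrow> v i = u i"
      "sum v {..<p} = f {..<p}"
      using ex_base by blast
    then have "v \<in> P" "u \<le> v" using u unfolding P by (auto simp: nat_vecs_def le_fun_def)
    then show "u \<in> down_closure p P" using u unfolding down_closure_def by blast
  qed
qed

lemma finite_indep:
  assumes "submodular_function {..<p} f"
  shows "finite {u \<in> nat_vecs p. submodular_function.indep {..<p} f u}"
proof -
  interpret submodular_function "{..<p}" f by fact
  have "u i \<le> f {..<p}" if u: "u \<in> nat_vecs p" "indep u" for u i
  proof (cases "i < p")
    case True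
    then have "u i \<le> sum u {..<p}" by (intro member_le_sum) auto
    then show ?thesis using indepD[OF u(2), of "{..<p}"] by simp
  qed (use u in \<open>simp add: nat_vecs_def\<close>)
  then have "{u \<in> nat_vecs p. indep u} \<subseteq> {u \<in> nat_vecs p. u \<le> (\<lambda>_. f {..<p})}"
    by (auto intro: le_funI)
  then show ?thesis using finite_nat_vecs_le by (rule finite_subset)
qed

lemma mu_supp_eq:
  assumes R: "submodular_function {..<p} f"
    and P: "P = {y \<in> nat_vecs p. submodular_function.indep {..<p} f y \<and> sum y {..<p} = f {..<p}}"
  shows "mu_supp p P = {u \<in> nat_vecs p. submodular_function.indep {..<p} f u \<and>
    (\<forall>B. B \<subset> {..<p} \<longrightarrow> f {..<p} < submodular_function.deficiency {..<p} f u B)}"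
proof -
  interpret submodular_function "{..<p}" f by fact
  let ?D = "{u \<in> nat_vecs p. indep u}"
  note D = down_closure_eq[OF R P]
  have "moebius (Gamma_poset p P) (top.Value u) top.Top \<noteq> 0 \<longleftrightarrow>
      (\<forall>B. B \<subset> {..<p} \<longrightarrow> f {..<p} < deficiency u B)" if u: "u \<in> ?D" for u
  proof -
    have "moebius (Gamma_poset p P) (top.Value u) top.Top =
        - alt_sum {..<p} (\<lambda>S. bump u S \<in> ?D)"
      unfolding Gamma_poset_def D
    proof (rule moebius_Top)
      show "w \<in> ?D" if "v \<in> ?D" "w \<in> nat_vecs p" "w \<le> v" for w v
        using that by (auto dest: le_funD intro: indep_antimono)
    qed (use finite_indep[OF R] u in auto)
    also have "alt_sum {..<p} (\<lambda>S. bump u S \<in> ?D) = alt_sum {..<p} (\<lambda>S. indep (bump u S))"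
      unfolding alt_sum_def using u bump_in_nat_vecs[of u p] by (intro sum.cong) auto
    finally show ?thesis
      using alt_sum_nonzero_iff[OF finite_E matroid_on_bump] no_coloop_iff u by simp
  qed
  then show ?thesis unfolding mu_supp_def D by auto
qed

text \<open>Write E = \<open>{..<p}\<close>. For X = B \<union> {p} the slack coordinate turns x(X)
  into f(E) - a(E - B), so the strict bound on the deficiency of \<open>B\<close> becomes x(X) \<le>
  f(B) + |E - B| - 1. Sets without \<open>p\<close> express independence.\<close>

lemma lift_mu_supp_eq:
  assumes R: "submodular_function {..<p} f"
    and G: "G = {u \<in> nat_vecs p. submodular_function.indep {..<p} f u \<and>
      (\<forall>B. B \<subset> {..<p} \<longrightarrow> f {..<p} < submodular_function.deficiency {..<p} f u B)}"
  shows "(\<lambda>a. a(p := f {..<p} - coord_sum p a)) ` G = {x \<in> nat_vecs (Suc p).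
    coord_sum (Suc p) x = f {..<p} \<and> (\<forall>X\<subseteq>{..<Suc p}. sum x X \<le> slack_rank p f X)}"
    (is "?lift ` G = ?Q")
proof -
  interpret submodular_function "{..<p}" f by fact
  have upd: "sum (a(p := c)) A = sum a A" if "p \<notin> A" for a :: "nat \<Rightarrow> nat" and c A
    using that by (intro sum.cong) auto
  have with_slack: "sum x X = x p + sum x (X - {p})" if "p \<in> X" "X \<subseteq> {..<Suc p}" for x :: "nat \<Rightarrow> nat" and X
    using that by (intro sum.remove) (auto intro: finite_subset)
  show ?thesis
  proof (intro equalityI subsetI)
    fix x assume "x \<in> ?lift ` G"
    then obtain a where a: "a \<in> G" and x: "x = a(p := f {..<p} - sum a {..<p})"
      by (auto simp: coord_sum_def)
    have av: "a \<in> nat_vecs p" "indep a" using a unfolding G by auto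
    have le: "sum a {..<p} \<le> f {..<p}" using av by (auto intro: indepD)
    have total: "coord_sum (Suc p) x = f {..<p}"
      using le unfolding coord_sum_def x by (simp add: upd)
    moreover have "x \<in> nat_vecs (Suc p)" using av unfolding x nat_vecs_def by auto
    moreover have "sum x X \<le> slack_rank p f X" if X: "X \<subseteq> {..<Suc p}" for X
    proof (cases "p \<in> X")
      case False
      then have "X \<subseteq> {..<p}" using X by (auto simp: lessThan_Suc)
      then show ?thesis
        using False indepD[OF av(2), of X] unfolding x upd[OF False] by (simp add: slack_rank_def)
    next
      case True
      show ?thesis
      proof (cases "X = {..<Suc p}")
        case True
        then show ?thesis using total by (simp add: coord_sum_def slack_rank_def)
      next
        case False
        let ?B = "X - {p}"
        have B: "?B \<subset> {..<p}" using X True False by (auto simp: lessThan_Suc)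
        then have "f {..<p} < f ?B + sum a ({..<p} - ?B) + card ({..<p} - ?B)"
          using a unfolding G deficiency_def by blast
        moreover have "sum a {..<p} = sum a ?B + sum a ({..<p} - ?B)"
          using B by (intro sum_split) auto
        moreover have "{..<p} - ?B = {..<p} - X" by auto
        moreover have "sum x X = (f {..<p} - sum a {..<p}) + sum a ?B"
          using with_slack[OF True X, of x] unfolding x by (simp add: upd)
        ultimately show ?thesis using slack_rank_in[OF X True False, of f] le by simp
      qed
    qed
    ultimately show "x \<in> ?Q" by blast
  next
    fix x assume x: "x \<in> ?Q"
    define a where "a = x(p := 0)"
    have sa: "sum a A = sum x A" if "p \<notin> A" for A using that unfolding a_def by (rule upd)
    have total: "x p + sum x {..<p} = f {..<p}"
      using x by (simp add: coord_sum_def)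
    have "a \<in> nat_vecs p" using x unfolding a_def nat_vecs_def by (auto simp: le_Suc_eq Suc_le_eq)
    moreover have "indep a"
      unfolding indep_def
    proof (intro allI impI)
      fix A :: "nat set" assume A: "A \<subseteq> {..<p}"
      then have "p \<notin> A" "A \<subseteq> {..<Suc p}" by auto
      then show "sum a A \<le> f A" using x sa[of A] by (auto simp: slack_rank_def dest: spec[of _ A])
    qed
    moreover have "f {..<p} < deficiency a B" if B: "B \<subset> {..<p}" for B
    proof -
      let ?X = "insert p B"
      have X: "?X \<subseteq> {..<Suc p}" "p \<notin> B" "p \<in> ?X" "?X \<noteq> {..<Suc p}"
        using B by (auto simp: lessThan_Suc)
      then have "sum x ?X \<le> slack_rank p f ?X" using x by blast
      moreover have "?X - {p} = B" "{..<p} - ?X = {..<p} - B" using X by auto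
      ultimately have "x p + sum x B + 1 \<le> f B + card ({..<p} - B)"
        using slack_rank_in[OF X(1,3,4), of f] with_slack[OF X(3,1), of x] by simp
      moreover have "sum x {..<p} = sum x B + sum x ({..<p} - B)"
        using B by (intro sum_split) auto
      moreover have "sum a ({..<p} - B) = sum x ({..<p} - B)" by (intro sa) auto
      ultimately show ?thesis using total by (simp add: deficiency_def)
    qed
    ultimately have "a \<in> G" unfolding G by blast
    moreover have "x = ?lift a"
      using total sa[of "{..<p}"] unfolding coord_sum_def by (auto simp: a_def fun_eq_iff)
    ultimately show "x \<in> ?lift ` G" by blast
  qed
qed

lemma generalized_polymatroid_mu_supp:
  assumes R: "submodular_function {..<p} f"
    and P: "P = {y \<in> nat_vecs p. submodular_function.indep {..<p} f y \<and> sum y {..<p} = f {..<p}}"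
  shows "generalized_polymatroid p (mu_supp p P)"
proof -
  interpret submodular_function "{..<p}" f by fact
  let ?G = "mu_supp p P"
  note G = mu_supp_eq[OF R P]
  have fin: "finite ?G" using finite_indep[OF R] unfolding G by (rule finite_subset[rotated]) auto
  have sub: "?G \<subseteq> nat_vecs p" unfolding G by auto
  \<comment> \<open>The maximal coordinate sum is the total rank: a base \<open>v\<close> attains
    it, and \<open>v\<close> lies in the support because its deficiency at \<open>B\<close> is at
    least the total rank plus the size of the nonempty complement of \<open>B\<close>.\<close>
  have "indep (\<lambda>_. 0)" by (simp add: indep_def)
  then obtain v where v: "indep v" "\<forall>i. i \<notin> {..<p} \<longrightarrow> v i = 0" "sum v {..<p} = f {..<p}"
    using ex_base by blast
  have "f {..<p} < deficiency v B" if B: "B \<subset> {..<p}" for B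
  proof -
    have "sum v {..<p} = sum v B + sum v ({..<p} - B)" using B by (intro sum_split) auto
    moreover have "sum v B \<le> f B" using v(1) B by (auto intro: indepD)
    moreover have "card ({..<p} - B) > 0" using B by (auto simp: card_gt_0_iff)
    ultimately show ?thesis using v(3) by (simp add: deficiency_def)
  qed
  then have "v \<in> ?G" using v unfolding G by (auto simp: nat_vecs_def)
  moreover have "coord_sum p u \<le> f {..<p}" if "u \<in> ?G" for u
    using that unfolding G coord_sum_def by (auto intro: indepD)
  ultimately have Max: "Max (coord_sum p ` ?G) = f {..<p}"
    using fin v(3) by (intro Max_eqI) (auto simp: coord_sum_def intro!: image_eqI[of _ _ v])
  have "polymatroid (Suc p) ((\<lambda>a. a(p := f {..<p} - coord_sum p a)) ` ?G)"
    unfolding polymatroid_def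
  proof (intro conjI ballI allI impI)
    show "finite ((\<lambda>a. a(p := f {..<p} - coord_sum p a)) ` ?G)" using fin by simp
    note Q = lift_mu_supp_eq[OF R G]
    show "(\<lambda>a. a(p := f {..<p} - coord_sum p a)) ` ?G \<subseteq> nat_vecs (Suc p)"
      unfolding Q by auto
    fix u v assume "u \<in> (\<lambda>a. a(p := f {..<p} - coord_sum p a)) ` ?G"
      and "v \<in> (\<lambda>a. a(p := f {..<p} - coord_sum p a)) ` ?G"
    note uv = this[unfolded Q]
    then show eq: "coord_sum (Suc p) u = coord_sum (Suc p) v" by simp
    fix i assume i: "i < Suc p" "v i < u i"
    have "\<exists>j\<in>{..<Suc p}. u j < v j \<and>
        (\<forall>X\<subseteq>{..<Suc p}. sum (u(i := u i - 1, j := u j + 1)) X \<le> slack_rank p f X)"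
    proof (rule tight_exchange)
      show "slack_rank p f {} = 0" by (simp add: slack_rank_def f_empty)
    qed (use uv i eq in \<open>auto simp: coord_sum_def intro!: slack_rank_submod[OF R]\<close>)
    then obtain j where j: "j < Suc p" "u j < v j"
      "\<And>X. X \<subseteq> {..<Suc p} \<Longrightarrow> sum (u(i := u i - 1, j := u j + 1)) X \<le> slack_rank p f X"
      by auto
    let ?w = "u(i := u i - 1, j := u j + 1)"
    have "bump ?w {i} = bump u {j}" using i j by (auto simp: bump_def fun_eq_iff)
    then have "sum ?w {..<Suc p} = sum u {..<Suc p}"
      using sum_bump[of "{..<Suc p}" ?w "{i}"] sum_bump[of "{..<Suc p}" u "{j}"] i j
      by (simp add: Int_absorb1 del: sum.lessThan_Suc)
    then have "coord_sum (Suc p) ?w = f {..<p}" using uv unfolding coord_sum_def by simp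
    moreover have "?w \<in> nat_vecs (Suc p)" using uv i j by (auto simp: nat_vecs_def)
    ultimately show "\<exists>j<Suc p. u j < v j \<and>
        u(i := u i - 1, j := u j + 1) \<in> (\<lambda>a. a(p := f {..<p} - coord_sum p a)) ` ?G"
      unfolding Q using j by blast
  qed
  then show ?thesis
    using fin sub by (simp add: generalized_polymatroid_def Max)
qed

section \<open>Submodularity of the dimensions of sums of subspaces\<close>

lemma (in module) sum_subspaces_eq_span:
  assumes "finite J" "\<And>j. j \<in> J \<Longrightarrow> subspace (V j)"
  shows "(\<Sum>j\<in>J. V j) = span (\<Union>j\<in>J. V j)"
  using assms
proof (induction J rule: finite_induct)
  case (insert j J)
  have "span (V j) = V j" using insert.prems by (intro span_eq_iff[THEN iffD2]) auto
  then have "span (V j \<union> (\<Union>j\<in>J. V j)) = V j + span (\<Union>j\<in>J. V j)"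
    unfolding span_Un set_plus_def by blast
  then show ?case using insert by simp
qed (simp add: set_zero)

text \<open>This is the dimension formula for two subspaces, together with the fact that the span
  over A \<inter> B lies in the intersection of the spans over \<open>A\<close> and
  \<open>B\<close>.\<close>

lemma submodular_function_dim:
  assumes "finite_dimensional_vector_space scale Basis" "finite E"
    and V: "\<And>j. j \<in> E \<Longrightarrow> module.subspace scale (V j)"
  shows "submodular_function E (\<lambda>J. vector_space.dim scale (\<Sum>j\<in>J. V j))"
proof -
  interpret finite_dimensional_vector_space scale Basis by fact
  have S: "(\<Sum>j\<in>J. V j) = span (\<Union>j\<in>J. V j)" if "J \<subseteq> E" for J
    using that V finite_subset[OF that \<open>finite E\<close>] by (intro sum_subspaces_eq_span) auto
  show ?thesis
  proof
    show "finite E" by fact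
    show "dim (\<Sum>j\<in>{}. V j) = 0" by (simp add: S)
    fix A B assume AB: "A \<subseteq> E" "B \<subseteq> E"
    let ?U = "\<lambda>J. span (\<Union>j\<in>J. V j)"
    have "?U (A \<union> B) = {x + y |x y. x \<in> ?U A \<and> y \<in> ?U B}"
      by (simp add: UN_Un span_Un)
    then have "dim (?U (A \<union> B)) + dim (?U A \<inter> ?U B) = dim (?U A) + dim (?U B)"
      using dim_sums_Int[of "?U A" "?U B"] by simp
    moreover have "dim (?U (A \<inter> B)) \<le> dim (?U A \<inter> ?U B)"
      by (intro dim_subset Int_greatest span_mono) auto
    moreover have "A \<union> B \<subseteq> E" "A \<inter> B \<subseteq> E" using AB by auto
    ultimately show "dim (\<Sum>j\<in>A \<union> B. V j) + dim (\<Sum>j\<in>A \<inter> B. V j)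
        \<le> dim (\<Sum>j\<in>A. V j) + dim (\<Sum>j\<in>B. V j)"
      using AB by (simp add: S del: dim_span)
  qed
qed

theorem theoremC:
  fixes scale :: "'k::field \<Rightarrow> 'v::ab_group_add \<Rightarrow> 'v"
    and p :: nat and P :: "(nat \<Rightarrow> nat) set"
  assumes "linear_polymatroid scale p P"
  shows "generalized_polymatroid p (mu_supp p P)"
proof -
  obtain Basis V where "finite_dimensional_vector_space scale Basis"
    and "\<And>j. j \<in> {..<p} \<Longrightarrow> module.subspace scale (V j)"
    and P: "P = {y \<in> nat_vecs p.
      (\<forall>J\<subseteq>{..<p}. (\<Sum>j\<in>J. y j) \<le> vector_space.dim scale (\<Sum>j\<in>J. V j)) \<and>
      (\<Sum>i<p. y i) = vector_space.dim scale (\<Sum>i<p. V i)}"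
    using assms unfolding linear_polymatroid_def by auto
  then have R: "submodular_function {..<p} (\<lambda>J. vector_space.dim scale (\<Sum>j\<in>J. V j))"
    by (intro submodular_function_dim) auto
  show ?thesis
    using R by (rule generalized_polymatroid_mu_supp) (simp add: P submodular_function.indep_def[OF R])
qed

end
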